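(* Define $G_{2n}(q)$ for $n\ge1$ by \[ \sum_{n\ge1}G_{2n}(q)z^{n-1}=\cfrac{1}{1-\cfrac{\lambda_1z}{1-\cfrac{\lambda_2z}{1-\cdots}}},\qquad \lambda_{2m-1}=[m]_q^2,\quad \lambda_{2m}=[m]_q[m+1]_q\ (m\ge1). \] For integers $k\ge -1$ let $P_k=\sum_{i=0}^{k}(-1)^i(2i+1)q^{\binom{k+1}{2}-\binom{i+1}{2}}$ (so $P_{-1}=0$), and for $k\ge0$ let $Y_k=\dfrac{P_{k-1}+2P_k+P_{k+1}}{q-1}$. Then each $Y_k$ is a polynomial in $q$, and for every $n\ge0$, \[ G_{2n+2}(q)=\frac{1}{(1-q)^{2n}}\sum_{k=0}^{n}\left(\binom{2n}{n-k}-\binom{2n}{n-k-1}\right)Y_k. \]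
   Context: $[m]_q=(1-q^m)/(1-q)$. The continued fraction is a formal power series in $z$ (limit of its finite truncations). Binomial coefficients with negative lower index are $0$. *)

theory Defs
  imports "HOL-Computational_Algebra.Computational_Algebra"
begin

text \<open>
  The indeterminate \<open>q\<close> is the variable of \<open>int poly\<close>; rational functions of \<open>q\<close> live in
  the fraction field \<open>int poly fract\<close>.
\<close>

definition q :: "int poly fract" where
  "q = to_fract [:0, 1:]"

definition qint :: "nat \<Rightarrow> int poly fract" where
  "qint m = (1 - q ^ m) / (1 - q)"

text \<open>
  \<open>S_trunc c N j\<close> is the finite continued fraction in the power series variable that uses the
  \<open>N\<close> coefficients \<open>c j, \<dots>, c (j + N - 1)\<close>:
  \<open>1 / (1 - c j z / (1 - c (j+1) z / (\<dots> / (1 - c (j+N-1) z))))\<close>.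
\<close>

fun S_trunc :: "(nat \<Rightarrow> 'a::field) \<Rightarrow> nat \<Rightarrow> nat \<Rightarrow> 'a fps" where
  "S_trunc c 0 j = 1"
| "S_trunc c (Suc N) j = 1 / (1 - fps_const (c j) * fps_X * S_trunc c N (Suc j))"

definition S_fraction :: "(nat \<Rightarrow> 'a::field) \<Rightarrow> 'a fps" where
  "S_fraction c = lim (\<lambda>N. S_trunc c N 1)"

lemma S_trunc_nth_Suc:
  "n \<le> N \<Longrightarrow> fps_nth (S_trunc c (Suc N) j) n = fps_nth (S_trunc c N j) n"
proof (induction N arbitrary: n j)
  case 0
  then show ?case by (simp add: fps_divide_unit)
next
  case (Suc N)
  define A where "A = 1 - fps_const (c j) * fps_X * S_trunc c (Suc N) (Suc j)"
  define B where "B = 1 - fps_const (c j) * fps_X * S_trunc c N (Suc j)"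
  have A0: "fps_nth A 0 = 1" and B0: "fps_nth B 0 = 1"
    by (simp_all add: A_def B_def)
  have AB: "fps_nth A m = fps_nth B m" if "m \<le> Suc N" for m
  proof (cases m)
    case (Suc m')
    then show ?thesis
      using Suc.IH[of m' "Suc j"] that
      by (simp add: A_def B_def mult.assoc del: S_trunc.simps)
  qed (simp add: A0 B0)
  have inv: "fps_nth (inverse A) m = fps_nth (inverse B) m" if "m \<le> Suc N" for m
    using that
  proof (induction m rule: less_induct)
    case (less m)
    show ?case
    proof (cases m)
      case 0
      then show ?thesis by (simp add: A0 B0)
    next
      case (Suc m')
      have *: "fps_nth (inverse D) m = - (\<Sum>i=0..<m. fps_nth D (m - i) * fps_nth (inverse D) i)"
        if D0: "fps_nth D 0 = 1" for D :: "'a fps"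
      proof -
        have "0 = fps_nth (inverse D * D) m"
          using D0 Suc by (simp add: inverse_mult_eq_1)
        also have "\<dots> = (\<Sum>i=0..m. fps_nth (inverse D) i * fps_nth D (m - i))"
          by (simp add: fps_mult_nth)
        also have "{0..m} = insert m {0..<m}" by auto
        finally show ?thesis
          using D0 by (simp add: eq_neg_iff_add_eq_0 mult.commute)
      qed
      show ?thesis
        unfolding *[OF A0] *[OF B0]
        using less by (intro arg_cong[of _ _ uminus] sum.cong refl) (simp add: AB)
    qed
  qed
  have "S_trunc c (Suc (Suc N)) j = inverse A" "S_trunc c (Suc N) j = inverse B"
    using A0 B0 by (simp_all add: A_def B_def fps_divide_unit)
  then show ?case using inv[OF Suc.prems] by simp
qed

lemma S_fraction_LIMSEQ: "(\<lambda>N. S_trunc c N 1) \<longlonglongrightarrow> S_fraction c"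
proof -
  have "fps_nth (S_trunc c (n + d) 1) n = fps_nth (S_trunc c n 1) n" for n d
    by (induction d) (simp_all add: S_trunc_nth_Suc del: S_trunc.simps)
  then have stable: "fps_nth (S_trunc c N 1) n = fps_nth (S_trunc c n 1) n" if "n \<le> N" for n N
    using that by (metis le_add_diff_inverse)
  have "(\<lambda>N. S_trunc c N 1) \<longlonglongrightarrow> Abs_fps (\<lambda>n. fps_nth (S_trunc c n 1) n)"
  proof (rule tendsto_fpsI)
    show "\<forall>\<^sub>F N in sequentially. fps_nth (S_trunc c N 1) n
        = fps_nth (Abs_fps (\<lambda>n. fps_nth (S_trunc c n 1) n)) n" for n
      unfolding fps_nth_Abs_fps by (rule eventually_sequentiallyI[of n]) (rule stable)
  qed
  then have "convergent (\<lambda>N. S_trunc c N 1)" by (rule convergentI)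
  then show ?thesis by (simp add: S_fraction_def convergent_LIMSEQ_iff)
qed

text \<open>Only the values at indices \<open>j \<ge> 1\<close> matter.\<close>

definition lam :: "nat \<Rightarrow> int poly fract" where
  "lam j = (if odd j then qint ((j + 1) div 2) ^ 2
            else qint (j div 2) * qint (j div 2 + 1))"

lemma lam_odd: "m \<ge> 1 \<Longrightarrow> lam (2 * m - 1) = qint m ^ 2"
  by (simp add: lam_def)

lemma lam_even: "lam (2 * m) = qint m * qint (m + 1)"
  by (simp add: lam_def)

text \<open>\<open>G2 n\<close> is \<open>G\<^bsub>2n\<^esub>(q)\<close>, meaningful for \<open>n \<ge> 1\<close>.\<close>

definition G2 :: "nat \<Rightarrow> int poly fract" where
  "G2 n = fps_nth (S_fraction lam) (n - 1)"

lemma G2_generating_function: "Abs_fps (\<lambda>n. G2 (n + 1)) = S_fraction lam"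
  by (simp add: fps_eq_iff G2_def)

text \<open>
  Intended for \<open>k \<ge> -1\<close>. The exponent is a subtraction of natural numbers but never
  truncates, since \<open>i \<le> k\<close>.
\<close>

definition P :: "int \<Rightarrow> int poly" where
  "P k = (\<Sum>i = 0..<nat (k + 1).
     monom ((-1) ^ i * (2 * int i + 1)) ((nat (k + 1) choose 2) - ((i + 1) choose 2)))"

definition Y :: "nat \<Rightarrow> int poly fract" where
  "Y k = to_fract (P (int k - 1) + 2 * P (int k) + P (int k + 1)) / (q - 1)"

definition ibinom :: "nat \<Rightarrow> int \<Rightarrow> int" where
  "ibinom n k = (if k < 0 then 0 else int (n choose nat k))"

end

theory Submission
  imports Defs
begin

text \<open>
  After rescaling by \<open>(1 - q)\<^sup>2\<close> the coefficients of the fraction become \<open>(1 - q\<^sup>m)\<^sup>2\<close> and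
  \<open>(1 - q\<^sup>m)(1 - q\<^bsup>m+1\<^esup>)\<close>, and the even orthogonal polynomials \<open>r\<^sub>n(y)\<close> attached to it are
  continuous dual \<open>q\<close>-Hahn polynomials. They are triangularly related to
  \<open>\<psi>\<^sub>k(y) = \<Prod>\<^bsub>i=1..k\<^esub> ((1 - q\<^sup>i)\<^sup>2 + q\<^sup>i y)\<close>, so a linear functional \<open>L\<close> with \<open>L 1 = 1\<close> has the
  coefficients of the fraction as moments as soon as
  \<open>L \<psi>\<^sub>k = (q;q)\<^sub>k (q;q)\<^bsub>k+1\<^esub> / (1 - q)\<close> for all \<open>k\<close>.

  Take for \<open>L\<close> the functional whose moments are the ballot sums of the \<open>Y\<^sub>k\<close>. With
  \<open>y = 2 + w + 1/w\<close> this means that \<open>L\<close> maps \<open>\<Sum>\<^bsub>|i|\<le>k\<^esub> w\<^sup>i\<close> to \<open>Y\<^sub>k\<close>. By the finite form of the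
  Jacobi triple product, \<open>\<psi>\<^sub>k\<close> is a combination of the alternating sums
  \<open>\<Sum>\<^bsub>|i|\<le>j\<^esub> (-1)\<^bsup>i+j\<^esup> w\<^sup>i\<close> with \<open>q\<close>-binomial coefficients, and \<open>L \<psi>\<^sub>k\<close> is then evaluated by
  summation by parts; what remains is the derivative at \<open>w = 1\<close> of the finite triple product.
\<close>

section \<open>Moments of a Stieltjes fraction\<close>

text \<open>The tail of the fraction from \<open>c j\<close> on. The diagonal gives its limit
  because coefficient \<open>n\<close> is already final in truncation \<open>n\<close>.\<close>

definition S_tail :: "(nat \<Rightarrow> 'a::field) \<Rightarrow> nat \<Rightarrow> 'a fps" where
  "S_tail c j = Abs_fps (\<lambda>n. fps_nth (S_trunc c n j) n)"

lemma S_trunc_nth_eq_S_tail: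
  assumes "n \<le> N"
  shows "fps_nth (S_trunc c N j) n = fps_nth (S_tail c j) n"
proof -
  have "fps_nth (S_trunc c (n + d) j) n = fps_nth (S_trunc c n j) n" for d
    by (induction d) (simp_all add: S_trunc_nth_Suc del: S_trunc.simps)
  from this[of "N - n"] show ?thesis
    using assms by (simp add: S_tail_def)
qed

lemma S_fraction_eq_S_tail: "S_fraction c = S_tail c 1"
proof -
  have "(\<lambda>N. S_trunc c N 1) \<longlonglongrightarrow> S_tail c 1"
    by (rule tendsto_fpsI)
      (auto intro!: eventually_sequentiallyI S_trunc_nth_eq_S_tail)
  then show ?thesis
    using S_fraction_LIMSEQ LIMSEQ_unique by blast
qed

text \<open>The relation \<open>F j = 1 / (1 - c j z F (j+1))\<close> without denominator. Each
  coefficient only sees truncations in which it is already final, so the recursion of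
  \<open>S_trunc\<close> passes to the limit.\<close>

lemma S_tail_eq:
  "S_tail c j = 1 + fps_const (c j) * fps_X * (S_tail c j * S_tail c (Suc j))"
proof (rule fps_ext)
  fix n
  define D where "D = 1 - fps_const (c j) * fps_X * S_trunc c n (Suc j)"
  have "fps_nth D 0 = 1" by (simp add: D_def)
  then have "S_trunc c (Suc n) j * D = 1"
    by (simp add: D_def[symmetric] fps_divide_unit inverse_mult_eq_1)
  then have eq: "S_trunc c (Suc n) j
      = 1 + fps_const (c j) * (fps_X * (S_trunc c (Suc n) j * S_trunc c n (Suc j)))"
    by (simp add: D_def algebra_simps del: S_trunc.simps)
  have "fps_nth (S_tail c j) n = fps_nth (S_trunc c (Suc n) j) n"
    by (rule S_trunc_nth_eq_S_tail[symmetric]) simp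
  also have "\<dots> = fps_nth (1 + fps_const (c j) * fps_X * (S_tail c j * S_tail c (Suc j))) n"
  proof (cases n)
    case (Suc m)
    have "fps_nth (S_trunc c (Suc n) j * S_trunc c n (Suc j)) m
        = fps_nth (S_tail c j * S_tail c (Suc j)) m"
      unfolding fps_mult_nth
      using Suc by (intro sum.cong refl arg_cong2[where f = times] S_trunc_nth_eq_S_tail) auto
    then show ?thesis
      by (subst eq) (simp add: Suc mult.assoc del: S_trunc.simps)
  qed (simp add: S_trunc_nth_eq_S_tail)
  finally show "fps_nth (S_tail c j) n
      = fps_nth (1 + fps_const (c j) * fps_X * (S_tail c j * S_tail c (Suc j))) n" .
qed

text \<open>
  Coefficient \<open>n\<close> of \<open>S_prod c h\<close> is the weighted number of paths from height \<open>0\<close> to height \<open>h\<close>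
  with \<open>n + h\<close> up-steps and \<open>n\<close> down-steps.
\<close>

primrec S_prod :: "(nat \<Rightarrow> 'a::field) \<Rightarrow> nat \<Rightarrow> 'a fps" where
  "S_prod c 0 = S_tail c 1"
| "S_prod c (Suc h) = S_prod c h * S_tail c (Suc (Suc h))"

lemma S_prod_0_eq: "S_prod c 0 = 1 + fps_const (c 1) * (fps_X * S_prod c 1)"
  using S_tail_eq[of c 1] by (simp add: mult.assoc numeral_2_eq_2)

lemma S_prod_Suc_eq:
  "S_prod c (Suc h) = S_prod c h
     + fps_const (c (Suc (Suc h))) * (fps_X * S_prod c (Suc (Suc h)))"
proof -
  have "S_prod c (Suc h) = S_prod c h * (1 + fps_const (c (Suc (Suc h))) * fps_X *
      (S_tail c (Suc (Suc h)) * S_tail c (Suc (Suc (Suc h)))))"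
    by (simp only: S_prod.simps S_tail_eq[symmetric])
  also have "\<dots> = S_prod c h
      + fps_const (c (Suc (Suc h))) * (fps_X * S_prod c (Suc (Suc h)))"
    by (simp add: algebra_simps)
  finally show ?thesis .
qed

text \<open>In terms of paths, these split off the last step, which goes up or down; a down-step
  from height \<open>j\<close> has weight \<open>c j\<close>.\<close>

lemma S_prod_nth:
  "fps_nth (S_prod c 0) 0 = 1"
  "fps_nth (S_prod c 0) (Suc n) = c 1 * fps_nth (S_prod c 1) n"
  "fps_nth (S_prod c (Suc h)) 0 = fps_nth (S_prod c h) 0"
  "fps_nth (S_prod c (Suc h)) (Suc n)
     = fps_nth (S_prod c h) (Suc n) + c (Suc (Suc h)) * fps_nth (S_prod c (Suc (Suc h))) n"
  by (subst S_prod_0_eq S_prod_Suc_eq, simp del: S_prod.simps)+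

text \<open>
  The monic orthogonal polynomials \<open>p\<^bsub>j+1\<^esub> = x p\<^sub>j - b\<^sub>j p\<^bsub>j-1\<^esub>\<close> in the variable \<open>y = x\<^sup>2\<close>:
  \<open>half_orth b (2n)\<close> is \<open>p\<^bsub>2n\<^esub>\<close> and \<open>half_orth b (2n+1)\<close> is \<open>p\<^bsub>2n+1\<^esub> / x\<close>.
\<close>

fun half_orth :: "(nat \<Rightarrow> 'a::field) \<Rightarrow> nat \<Rightarrow> 'a poly" where
  "half_orth b 0 = 1"
| "half_orth b (Suc 0) = 1"
| "half_orth b (Suc (Suc j)) =
     (if even j then [:0, 1:] * half_orth b (Suc j) else half_orth b (Suc j))
     - smult (b (Suc j)) (half_orth b j)"

lemma half_orth_even:
  "half_orth b (2 * Suc h) = half_orth b (2 * Suc h + 1) + smult (b (2 * Suc h)) (half_orth b (2 * h + 1))"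
  by simp

lemma half_orth_odd:
  "[:0, 1:] * half_orth b (2 * h + 1)
     = half_orth b (2 * Suc h) + smult (b (2 * h + 1)) (half_orth b (2 * h))"
  by simp

text \<open>Summed form of \<open>half_orth_even\<close>. The inner induction keeps the boundary
  term at \<open>m + 1\<close>, which the assumption then removes; \<open>half_orth_odd_sum\<close>
  works in the same way.\<close>

lemma half_orth_even_sum:
  assumes "f (Suc n) = 0"
  shows "(\<Sum>h\<le>n. smult (f h) (half_orth b (2 * h)))
       = (\<Sum>h\<le>n. smult (f h + b (2 * Suc h) * f (Suc h)) (half_orth b (2 * h + 1)))"
proof -
  have "(\<Sum>h\<le>m. smult (f h) (half_orth b (2 * h)))
        + smult (b (2 * Suc m) * f (Suc m)) (half_orth b (2 * m + 1))
      = (\<Sum>h\<le>m. smult (f h + b (2 * Suc h) * f (Suc h)) (half_orth b (2 * h + 1)))" for m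
  proof (induction m)
    case (Suc m)
    show ?case
      unfolding sum.atMost_Suc Suc[symmetric] half_orth_even[of b m]
      by (simp add: smult_add_left smult_add_right mult.commute del: half_orth.simps)
  qed (simp add: smult_add_left)
  from this[of n] show ?thesis
    using assms by simp
qed

lemma half_orth_odd_sum:
  assumes "g (Suc n) = 0"
  shows "[:0, 1:] * (\<Sum>h\<le>n. smult (g h) (half_orth b (2 * h + 1)))
       = (\<Sum>h\<le>Suc n. smult ((case h of 0 \<Rightarrow> 0 | Suc m \<Rightarrow> g m) + b (2 * h + 1) * g h)
           (half_orth b (2 * h)))"
proof -
  have "[:0, 1:] * (\<Sum>h\<le>m. smult (g h) (half_orth b (2 * h + 1)))
        + smult (b (2 * Suc m + 1) * g (Suc m)) (half_orth b (2 * Suc m))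
      = (\<Sum>h\<le>Suc m. smult ((case h of 0 \<Rightarrow> 0 | Suc m \<Rightarrow> g m) + b (2 * h + 1) * g h)
           (half_orth b (2 * h)))" for m
  proof (induction m)
    case 0
    show ?case
      by (simp add: smult_add_left smult_diff_right mult.commute numeral_2_eq_2)
  next
    case (Suc m)
    show ?case
      unfolding sum.atMost_Suc[of _ "Suc m"] Suc[symmetric] sum.atMost_Suc[of _ m]
        distrib_left mult_smult_right half_orth_odd
      by (simp add: smult_add_left smult_add_right mult.commute
          del: half_orth.simps mult_Suc_right)
  qed
  from this[of n] show ?thesis
    using assms by simp
qed

lemma smult_sum_right: "smult x (\<Sum>i\<in>I. f i) = (\<Sum>i\<in>I. smult x (f i))"
  by (induction I rule: infinite_finite_induct) (simp_all add: smult_add_right)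

text \<open>Path weights and expansion coefficients obey the same recursion, taken in two
  half-steps. A path of length \<open>2n\<close> to height \<open>2h\<close> has
  \<open>n - h\<close> down-steps, whence the power of \<open>a\<close>.\<close>

lemma power_expansion:
  fixes c :: "nat \<Rightarrow> 'a::field"
  assumes b: "\<And>j. b j = a * c j"
  shows "[:0, 1:] ^ n
       = (\<Sum>h\<le>n. smult (a ^ (n - h) * fps_nth (S_prod c (2 * h)) (n - h)) (half_orth b (2 * h)))"
proof (induction n)
  case 0
  show ?case using S_prod_nth(1)[of c] by simp
next
  case (Suc n)
  \<comment> \<open>Cutting off beyond \<open>n\<close> provides the boundary zeros required by the
    two half-step lemmas.\<close>
  define f where
    "f n h = (if h \<le> n then a ^ (n - h) * fps_nth (S_prod c (2 * h)) (n - h) else 0)" for n h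
  define g where
    "g h = (if h \<le> n then a ^ (n - h) * fps_nth (S_prod c (2 * h + 1)) (n - h) else 0)" for h
  have g: "g h = f n h + b (2 * Suc h) * f n (Suc h)" if "h \<le> n" for h
  proof (cases "h = n")
    case False
    with that have "n - h = Suc (n - Suc h)" "Suc h \<le> n" by simp_all
    then show ?thesis
      by (simp add: g_def f_def b S_prod_nth algebra_simps del: S_prod.simps)
  qed (simp add: g_def f_def S_prod_nth del: S_prod.simps)
  have f: "f (Suc n) h = (case h of 0 \<Rightarrow> 0 | Suc m \<Rightarrow> g m) + b (2 * h + 1) * g h"
    if "h \<le> Suc n" for h
  proof (cases h)
    case 0
    then show ?thesis
      by (simp add: g_def f_def b S_prod_nth del: S_prod.simps)
  next
    case (Suc m)
    show ?thesis
    proof (cases "m = n")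
      case False
      with that Suc have "n - m = Suc (n - Suc m)" "Suc m \<le> n" by simp_all
      with Suc show ?thesis
        by (simp add: g_def f_def b S_prod_nth algebra_simps del: S_prod.simps)
    qed (simp add: Suc g_def f_def S_prod_nth del: S_prod.simps)
  qed
  have "[:0, 1:] ^ n = (\<Sum>h\<le>n. smult (f n h) (half_orth b (2 * h)))"
    using Suc by (simp add: f_def)
  also have "\<dots> = (\<Sum>h\<le>n. smult (g h) (half_orth b (2 * h + 1)))"
    by (subst half_orth_even_sum) (simp_all add: f_def[of n "Suc n"] g)
  finally have "[:0, 1:] ^ Suc n
      = [:0, 1:] * (\<Sum>h\<le>n. smult (g h) (half_orth b (2 * h + 1)))"
    by (simp only: power_Suc)
  also have "\<dots> = (\<Sum>h\<le>Suc n. smult (f (Suc n) h) (half_orth b (2 * h)))"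
    by (subst half_orth_odd_sum) (auto simp: g_def[of "Suc n"] f intro!: sum.cong)
  finally show ?case
    by (simp add: f_def)
qed

locale poly_functional =
  fixes L :: "'a::field poly \<Rightarrow> 'a"
  assumes L_add: "L (p + r) = L p + L r"
    and L_smult: "L (smult x p) = x * L p"
begin

lemma L_zero: "L 0 = 0"
  using L_smult[of 0 0] by simp

lemma L_diff: "L (p - r) = L p - L r"
  using L_add[of "p - r" r] by simp

lemma L_sum: "L (\<Sum>i\<in>I. f i) = (\<Sum>i\<in>I. L (f i))"
  by (induction I rule: infinite_finite_induct) (simp_all add: L_zero L_add)

text \<open>Orthogonality kills every term of \<open>power_expansion\<close> except
  \<open>h = 0\<close>, whose weight is coefficient \<open>n\<close> of the fraction.\<close>

lemma moments_eq_S_fraction: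
  assumes b: "\<And>j. b j = a * c j"
    and one: "L 1 = 1"
    and orth: "\<And>n. n \<ge> 1 \<Longrightarrow> L (half_orth b (2 * n)) = 0"
  shows "L ([:0, 1:] ^ n) = a ^ n * fps_nth (S_fraction c) n"
proof -
  have "L ([:0, 1:] ^ n) = (\<Sum>h\<le>n. a ^ (n - h) * fps_nth (S_prod c (2 * h)) (n - h)
      * L (half_orth b (2 * h)))"
    by (simp only: power_expansion[of b a c, OF b] L_sum L_smult)
  also have "\<dots> = (\<Sum>h\<in>{0}. a ^ (n - h) * fps_nth (S_prod c (2 * h)) (n - h)
      * L (half_orth b (2 * h)))"
    by (rule sum.mono_neutral_right) (auto simp: orth)
  finally show ?thesis
    by (simp add: one S_fraction_eq_S_tail)
qed

end

section \<open>The product basis and the orthogonal polynomials\<close>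

lemma Suc_choose_two: "Suc n choose 2 = (n choose 2) + n"
  by (simp add: numeral_2_eq_2)

lemma power_Suc_mult_diff:
  fixes u :: "'a::comm_ring_1"
  shows "k \<le> n \<Longrightarrow> u ^ Suc k * u ^ (n - k) = u ^ Suc n"
  by (simp del: power_Suc flip: power_add)

fun qbinom :: "'a::comm_ring_1 \<Rightarrow> nat \<Rightarrow> nat \<Rightarrow> 'a" where
  "qbinom u n 0 = 1"
| "qbinom u 0 (Suc k) = 0"
| "qbinom u (Suc n) (Suc k) = qbinom u n k + u ^ Suc k * qbinom u n (Suc k)"

lemma qbinom_eq_0: "n < k \<Longrightarrow> qbinom u n k = 0"
proof (induction n arbitrary: k)
  case 0
  then show ?case by (cases k) simp_all
next
  case (Suc n)
  then show ?case by (cases k) simp_all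
qed

lemma qbinom_self: "qbinom u n n = 1"
  by (induction n) (simp_all add: qbinom_eq_0)

text \<open>The quotient of neighbours in a row, cross-multiplied; for \<open>k \<ge> n\<close> both
  sides vanish. It yields the second Pascal rule and, at the centre of an odd row, the
  symmetry.\<close>

lemma qbinom_ratio:
  "(1 - u ^ Suc k) * qbinom u n (Suc k) = (1 - u ^ (n - k)) * qbinom u n k"
proof (induction n arbitrary: k)
  case 0
  show ?case by (cases k) simp_all
next
  case (Suc n)
  show ?case
  proof (cases "k \<le> n")
    case True
    have "(1 - u ^ Suc k) * qbinom u (Suc n) (Suc k)
        = (1 - u ^ Suc k) * qbinom u n k + u ^ Suc k * ((1 - u ^ Suc k) * qbinom u n (Suc k))"
      by (simp add: algebra_simps)
    also have "\<dots> = (1 - u ^ Suc k * u ^ (n - k)) * qbinom u n k"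
      unfolding Suc.IH by (simp add: algebra_simps)
    also have "u ^ Suc k * u ^ (n - k) = u ^ Suc n"
      using True by (rule power_Suc_mult_diff)
    also have "(1 - u ^ Suc n) * qbinom u n k = (1 - u ^ (Suc n - k)) * qbinom u (Suc n) k"
    proof (cases k)
      case (Suc j)
      have "(1 - u ^ (n - j)) * qbinom u (Suc n) (Suc j)
          = (1 - u ^ (n - j)) * qbinom u n j
            + (u ^ Suc j - u ^ Suc j * u ^ (n - j)) * qbinom u n (Suc j)"
        by (simp add: algebra_simps)
      also have "u ^ Suc j * u ^ (n - j) = u ^ Suc n"
        using True Suc by (intro power_Suc_mult_diff) simp
      also have "(1 - u ^ (n - j)) * qbinom u n j = (1 - u ^ Suc j) * qbinom u n (Suc j)"
        by (rule Suc.IH[symmetric])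
      finally show ?thesis
        using Suc by (simp add: algebra_simps)
    qed simp
    finally show ?thesis .
  qed (cases "k = Suc n", simp_all add: qbinom_eq_0 qbinom_self)
qed

lemma qbinom_Suc_Suc':
  "qbinom u (Suc n) (Suc k) = qbinom u n (Suc k) + u ^ (n - k) * qbinom u n k"
  using qbinom_ratio[of u k n] by (simp add: algebra_simps)

lemma qbinom_absorb:
  assumes "k \<le> n"
  shows "(1 - u ^ Suc k) * qbinom u (Suc n) (Suc k) = (1 - u ^ Suc n) * qbinom u n k"
proof -
  have "(1 - u ^ Suc k) * qbinom u (Suc n) (Suc k)
      = (1 - u ^ Suc k) * qbinom u n k + u ^ Suc k * ((1 - u ^ Suc k) * qbinom u n (Suc k))"
    by (simp add: algebra_simps)
  also have "\<dots> = (1 - u ^ Suc k * u ^ (n - k)) * qbinom u n k"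
    unfolding qbinom_ratio by (simp add: algebra_simps)
  also have "u ^ Suc k * u ^ (n - k) = u ^ Suc n"
    using assms by (rule power_Suc_mult_diff)
  finally show ?thesis .
qed

primrec qpoch :: "'a::comm_ring_1 \<Rightarrow> nat \<Rightarrow> 'a" where
  "qpoch u 0 = 1"
| "qpoch u (Suc n) = qpoch u n * (1 - u ^ Suc n)"

section \<open>Connection coefficients between the product basis and the orthogonal
  polynomials\<close>

locale non_root_of_unity =
  fixes u :: "'a::field"
  assumes u_nonzero: "u \<noteq> 0"
    and u_power_neq_1: "m > 0 \<Longrightarrow> u ^ m \<noteq> 1"
begin

lemma one_minus_power_nonzero: "1 - u ^ Suc m \<noteq> 0"
  using u_power_neq_1[of "Suc m"] by simp

lemma qpoch_nonzero: "qpoch u n \<noteq> 0"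
  by (induction n) (simp_all only: qpoch.simps mult_eq_0_iff one_minus_power_nonzero, simp_all)

lemma qbinom_middle: "qbinom u (Suc (2 * n)) (Suc n) = qbinom u (Suc (2 * n)) n"
proof -
  have "Suc (2 * n) - n = Suc n" by simp
  with qbinom_ratio[of u n "Suc (2 * n)"] show ?thesis
    using one_minus_power_nonzero[of n]
    by (simp del: power_Suc qbinom.simps)
qed

primrec psi :: "nat \<Rightarrow> 'a poly" where
  "psi 0 = 1"
| "psi (Suc k) = [:(1 - u ^ Suc k)\<^sup>2, u ^ Suc k:] * psi k"

text \<open>The coefficients of \<open>psi k\<close> in the polynomials
  \<open>half_orth b (2 * n)\<close>; those of \<open>kappa_odd\<close> belong to
  \<open>half_orth b (2 * n + 1)\<close>.\<close>

definition kappa_even :: "nat \<Rightarrow> nat \<Rightarrow> 'a" where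
  "kappa_even k n = qbinom u k n * u ^ (Suc n choose 2)
     * (qpoch u k * qpoch u (Suc k)) / (qpoch u n * qpoch u (Suc n))"

definition kappa_odd :: "nat \<Rightarrow> nat \<Rightarrow> 'a" where
  "kappa_odd k n = qbinom u k n * u ^ (Suc n choose 2)
     * (qpoch u (Suc k))\<^sup>2 / (qpoch u (Suc n))\<^sup>2"

lemma kappa_odd_eq:
  "kappa_odd k n = (1 - u ^ Suc k) / (1 - u ^ Suc n) * kappa_even k n"
proof -
  have "B * (a * y)\<^sup>2 / (c * x)\<^sup>2 = y / x * (B * (a * (a * y)) / (c * (c * x)))"
    if "c \<noteq> 0" "x \<noteq> 0" for B a c x y :: 'a
    using that by (simp add: field_simps power2_eq_square)
  then show ?thesis
    unfolding kappa_odd_def kappa_even_def qpoch.simps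
    by (simp only: qpoch_nonzero one_minus_power_nonzero not_False_eq_True)
qed

lemma kappa_even_Suc_right:
  "kappa_even k (Suc n) = u ^ Suc n * (1 - u ^ (k - n))
     / ((1 - u ^ Suc n)\<^sup>2 * (1 - u ^ Suc (Suc n))) * kappa_even k n"
proof -
  have "qbinom u k (Suc n) = (1 - u ^ (k - n)) * qbinom u k n / (1 - u ^ Suc n)"
    using qbinom_ratio[of u n k] one_minus_power_nonzero[of n]
    by (simp add: eq_divide_eq mult.commute del: power_Suc)
  moreover have "(w * b / x) * (t * v) * A / (c * x * (c * x * x'))
      = v * w / (x\<^sup>2 * x') * (b * t * A / (c * (c * x)))"
    if "c \<noteq> 0" "x \<noteq> 0" "x' \<noteq> 0" for w b x x' t v A c :: 'a
    using that by (simp add: field_simps power2_eq_square)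
  ultimately show ?thesis
    unfolding kappa_even_def qpoch.simps Suc_choose_two[of "Suc n"] power_add
    by (simp only: qpoch_nonzero one_minus_power_nonzero not_False_eq_True)
qed

lemma kappa_even_Suc_Suc:
  assumes "n \<le> k"
  shows "kappa_even (Suc k) (Suc n) = u ^ Suc n * (1 - u ^ Suc k)\<^sup>2 * (1 - u ^ Suc (Suc k))
     / ((1 - u ^ Suc n)\<^sup>2 * (1 - u ^ Suc (Suc n))) * kappa_even k n"
proof -
  have "qbinom u (Suc k) (Suc n) = (1 - u ^ Suc k) * qbinom u k n / (1 - u ^ Suc n)"
    using qbinom_absorb[OF assms, of u] one_minus_power_nonzero[of n]
    by (simp add: eq_divide_eq mult.commute del: power_Suc qbinom.simps)
  moreover have "(y * b / x) * (t * v) * (a * y * (a * y * y')) / (c * x * (c * x * x'))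
      = v * y\<^sup>2 * y' / (x\<^sup>2 * x') * (b * t * (a * (a * y)) / (c * (c * x)))"
    if "c \<noteq> 0" "x \<noteq> 0" "x' \<noteq> 0" for y y' b x x' t v a c :: 'a
    using that by (simp add: field_simps power2_eq_square)
  ultimately show ?thesis
    unfolding kappa_even_def qpoch.simps Suc_choose_two[of "Suc n"] power_add
    by (simp only: qpoch_nonzero one_minus_power_nonzero not_False_eq_True)
qed

lemma kappa_odd_step:
  assumes "n \<le> k"
  shows "kappa_odd k n
    = kappa_even k n + (1 - u ^ Suc n) * (1 - u ^ Suc (Suc n)) * kappa_even k (Suc n)"
proof -
  define x where "x = 1 - u ^ Suc n"
  define x' where "x' = 1 - u ^ Suc (Suc n)"
  have nz: "x \<noteq> 0" "x' \<noteq> 0"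
    unfolding x_def x'_def by (rule one_minus_power_nonzero)+
  have "u ^ Suc k = u ^ Suc n * u ^ (k - n)"
    by (rule power_Suc_mult_diff[OF assms, symmetric])
  then have k: "1 - u ^ Suc k = x + u ^ Suc n * (1 - u ^ (k - n))"
    by (simp add: x_def algebra_simps del: power_Suc)
  show ?thesis
    unfolding kappa_odd_eq kappa_even_Suc_right k x_def[symmetric] x'_def[symmetric]
    using nz by (simp add: field_simps power2_eq_square del: power_Suc)
qed

text \<open>This is exactly the value prescribed for \<open>L (psi k)\<close>, so that prescription
  amounts to orthogonality.\<close>

lemma kappa_even_0_right: "kappa_even k 0 = qpoch u k * qpoch u (Suc k) / (1 - u)"
  by (simp add: kappa_even_def binomial_eq_0)

lemma kappa_even_step_0:
  "kappa_even (Suc k) 0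
    = (1 - u ^ Suc k)\<^sup>2 * kappa_even k 0 + u ^ Suc k * ((1 - u)\<^sup>2 * kappa_odd k 0)"
proof -
  define v where "v = u ^ Suc k"
  have nz: "1 - u \<noteq> 0" using one_minus_power_nonzero[of 0] by simp
  have A: "kappa_even (Suc k) 0 = (1 - v) * (1 - u * v) * kappa_even k 0"
    unfolding kappa_even_0_right qpoch.simps v_def by (simp add: mult_ac)
  have B: "(1 - u)\<^sup>2 * kappa_odd k 0 = (1 - u) * (1 - v) * kappa_even k 0"
    unfolding kappa_odd_eq v_def[symmetric] using nz by (simp add: power2_eq_square)
  show ?thesis
    unfolding v_def[symmetric] A B by (simp add: algebra_simps power2_eq_square)
qed

text \<open>Coefficient form of multiplying \<open>psi k\<close> by
  \<open>(1 - u^(k+1))^2 + u^(k+1) y\<close>.\<close>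

lemma kappa_even_step_Suc:
  assumes "n \<le> k"
  shows "kappa_even (Suc k) (Suc n) = (1 - u ^ Suc k)\<^sup>2 * kappa_even k (Suc n)
    + u ^ Suc k * (kappa_odd k n + (1 - u ^ Suc (Suc n))\<^sup>2 * kappa_odd k (Suc n))"
proof -
  \<comment> \<open>Every term is a rational multiple of \<open>kappa_even k n\<close>, so the claim
    becomes a rational identity in \<open>u\<close>, \<open>v\<close> and \<open>w\<close>.\<close>
  define v where "v = u ^ Suc n"
  define w where "w = u ^ (k - n)"
  have nz: "1 - v \<noteq> 0" "1 - u * v \<noteq> 0"
    using one_minus_power_nonzero[of n] one_minus_power_nonzero[of "Suc n"]
    by (simp_all add: v_def)
  have "u ^ Suc k = u ^ Suc n * u ^ (k - n)"
    by (rule power_Suc_mult_diff[OF assms, symmetric])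
  then have k: "u ^ Suc k = v * w" "u ^ Suc (Suc k) = u * v * w" "u ^ Suc (Suc n) = u * v"
    by (simp_all add: v_def w_def)
  show ?thesis
    unfolding kappa_even_Suc_Suc[OF assms]
    unfolding kappa_odd_eq kappa_even_Suc_right
      k v_def[symmetric] w_def[symmetric]
    using nz by (simp add: divide_simps power2_eq_square) (simp add: algebra_simps)
qed

lemma kappa_even_eq_0: "k < n \<Longrightarrow> kappa_even k n = 0"
  and kappa_odd_eq_0: "k < n \<Longrightarrow> kappa_odd k n = 0"
  by (simp_all add: kappa_even_def kappa_odd_def qbinom_eq_0)

lemma kappa_even_self_nonzero: "kappa_even k k \<noteq> 0"
  unfolding kappa_even_def qbinom_self using qpoch_nonzero u_nonzero by (simp del: qpoch.simps)

lemma psi_expansion: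
  assumes b_odd: "\<And>n. b (2 * n + 1) = (1 - u ^ Suc n)\<^sup>2"
    and b_even: "\<And>n. b (2 * Suc n) = (1 - u ^ Suc n) * (1 - u ^ Suc (Suc n))"
  shows "psi k = (\<Sum>n\<le>k. smult (kappa_even k n) (half_orth b (2 * n)))"
proof (induction k)
  case 0
  show ?case using u_power_neq_1[of 1] by (simp add: kappa_even_0_right)
next
  case (Suc k)
  define f where "f n = (case n of 0 \<Rightarrow> 0 | Suc m \<Rightarrow> kappa_odd k m) + b (2 * n + 1) * kappa_odd k n" for n
  have f: "kappa_even (Suc k) n = (1 - u ^ Suc k)\<^sup>2 * kappa_even k n + u ^ Suc k * f n"
    if "n \<le> Suc k" for n
  proof (cases n)
    case 0
    then show ?thesis
      unfolding f_def b_odd using kappa_even_step_0[of k] by simp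
  next
    case (Suc m)
    then show ?thesis
      unfolding f_def b_odd using kappa_even_step_Suc[of m k] that by simp
  qed
  \<comment> \<open>The odd polynomials come in because \<open>half_orth_odd\<close> expresses
    \<open>y\<close> times each of them in even ones.\<close>
  have "psi k = (\<Sum>n\<le>k. smult (kappa_odd k n) (half_orth b (2 * n + 1)))"
    unfolding Suc half_orth_even_sum[where f = "kappa_even k" and n = k, OF kappa_even_eq_0[OF lessI]]
    by (intro sum.cong refl) (simp only: b_even kappa_odd_step atMost_iff)
  then have y: "[:0, 1:] * psi k = (\<Sum>n\<le>Suc k. smult (f n) (half_orth b (2 * n)))"
    unfolding f_def using half_orth_odd_sum[where g = "kappa_odd k" and n = k and b = b, OF kappa_odd_eq_0[OF lessI]]
    by simp
  have "psi (Suc k) = smult ((1 - u ^ Suc k)\<^sup>2) (psi k) + smult (u ^ Suc k) ([:0, 1:] * psi k)"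
    by (simp add: algebra_simps)
  also note y
  also have "psi k = (\<Sum>n\<le>Suc k. smult (kappa_even k n) (half_orth b (2 * n)))"
    by (simp add: Suc kappa_even_eq_0)
  also have "smult ((1 - u ^ Suc k)\<^sup>2) (\<Sum>n\<le>Suc k. smult (kappa_even k n) (half_orth b (2 * n)))
      + smult (u ^ Suc k) (\<Sum>n\<le>Suc k. smult (f n) (half_orth b (2 * n)))
      = (\<Sum>n\<le>Suc k. smult (kappa_even (Suc k) n) (half_orth b (2 * n)))"
    unfolding smult_sum_right sum.distrib[symmetric] smult_smult smult_add_left[symmetric]
    by (intro sum.cong refl) (simp only: f atMost_iff)
  finally show ?case .
qed

text \<open>By induction only the terms \<open>m = 0\<close> and \<open>m = n\<close> of
  \<open>psi n\<close> survive. The first already equals \<open>L (psi n)\<close>, and the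
  coefficient of the other is nonzero.\<close>

lemma half_orth_functional_zero:
  assumes "poly_functional L"
    and psi: "\<And>k. L (psi k) = qpoch u k * qpoch u (Suc k) / (1 - u)"
    and b_odd: "\<And>n. b (2 * n + 1) = (1 - u ^ Suc n)\<^sup>2"
    and b_even: "\<And>n. b (2 * Suc n) = (1 - u ^ Suc n) * (1 - u ^ Suc (Suc n))"
    and "n \<ge> 1"
  shows "L (half_orth b (2 * n)) = 0"
  using \<open>n \<ge> 1\<close>
proof (induction n rule: less_induct)
  case (less n)
  interpret poly_functional L by fact
  have L1: "L 1 = 1"
    using psi[of 0] u_power_neq_1[of 1] by simp
  have "kappa_even n 0 = L (psi n)"
    by (simp only: psi kappa_even_0_right)
  also have "\<dots> = (\<Sum>m\<le>n. kappa_even n m * L (half_orth b (2 * m)))"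
    unfolding psi_expansion[of b, OF b_odd b_even] L_sum L_smult ..
  also have "\<dots> = (\<Sum>m\<in>{0, n}. kappa_even n m * L (half_orth b (2 * m)))"
    using less by (intro sum.mono_neutral_right) auto
  also have "\<dots> = kappa_even n 0 + kappa_even n n * L (half_orth b (2 * n))"
    using less.prems L1 by simp
  finally show ?case
    using kappa_even_self_nonzero[of n] by simp
qed

end

section \<open>Chebyshev-type bases\<close>

text \<open>
  With \<open>y = 2 + w + 1/w\<close>, \<open>cheb 1 k\<close> is \<open>\<Sum>\<^bsub>|i|\<le>k\<^esub> w\<^sup>i\<close> and \<open>cheb 3 k\<close> is
  \<open>\<Sum>\<^bsub>|i|\<le>k\<^esub> (-1)\<^bsup>i+k\<^esup> w\<^sup>i\<close>.
\<close>

fun cheb :: "'a::comm_ring_1 \<Rightarrow> nat \<Rightarrow> 'a poly" where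
  "cheb a 0 = 1"
| "cheb a (Suc 0) = [:- a, 1:]"
| "cheb a (Suc (Suc n)) = [:-2, 1:] * cheb a (Suc n) - cheb a n"

text \<open>In the variable \<open>w\<close> both sides are \<open>w^(j+1) + w^(-j-1)\<close>. The
  proof compares three-term recursions instead.\<close>

lemma cheb_3_add: "cheb 3 (Suc j) + cheb 3 j = cheb 1 (Suc j) - cheb 1 j"
proof (induction j rule: less_induct)
  case (less j)
  consider "j = 0" | "j = 1" | i where "j = Suc (Suc i)"
    by (metis One_nat_def nat.exhaust)
  then show ?case
  proof cases
    case 3
    have "cheb 3 (Suc j) + cheb 3 j
        = [:-2, 1:] * (cheb 3 (Suc (Suc i)) + cheb 3 (Suc i)) - (cheb 3 (Suc i) + cheb 3 i :: 'a poly)"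
      unfolding 3 cheb.simps(3)[of _ "Suc i"] by (subst (2) cheb.simps(3)) (simp only: algebra_simps)
    also have "\<dots> = [:-2, 1:] * (cheb 1 (Suc (Suc i)) - cheb 1 (Suc i)) - (cheb 1 (Suc i) - cheb 1 i)"
      using less[of "Suc i"] less[of i] 3 by simp
    also have "\<dots> = cheb 1 (Suc j) - cheb 1 j"
      unfolding 3 cheb.simps(3)[of _ "Suc i"] by (subst (3) cheb.simps(3)) (simp only: algebra_simps)
    finally show ?thesis .
  qed (simp_all add: numeral_poly)
qed

lemma times_cheb_0: "[:0, 1:] * cheb a 0 = cheb a 1 + smult a (cheb a 0)"
  by simp

lemma times_cheb_Suc:
  "[:0, 1:] * cheb a (Suc k) = cheb a (Suc (Suc k)) + smult 2 (cheb a (Suc k)) + cheb a k"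
  by simp

lemma times_cheb_sum:
  assumes "f (Suc n) = 0" "f (Suc (Suc n)) = 0"
  shows "[:0, 1:] * (\<Sum>k\<le>n. smult (f k) (cheb a k))
    = (\<Sum>k\<le>Suc n. smult (case k of 0 \<Rightarrow> a * f 0 + f 1
          | Suc j \<Rightarrow> f j + 2 * f (Suc j) + f (Suc (Suc j))) (cheb a k))"
proof -
  define g where "g k = (case k of 0 \<Rightarrow> a * f 0 + f 1
      | Suc j \<Rightarrow> f j + 2 * f (Suc j) + f (Suc (Suc j)))" for k
  have "(\<Sum>k\<le>Suc m. smult (g k) (cheb a k))
      = [:0, 1:] * (\<Sum>k\<le>m. smult (f k) (cheb a k))
        + smult (f (Suc m)) (cheb a m) + smult (2 * f (Suc m) + f (Suc (Suc m))) (cheb a (Suc m))" for m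
  proof (induction m)
    case 0
    show ?case by (simp add: g_def algebra_simps smult_add_left)
  next
    case (Suc m)
    show ?case
      unfolding sum.atMost_Suc[of _ "Suc m"] Suc
      unfolding sum.atMost_Suc[of _ m] distrib_left mult_smult_right times_cheb_Suc g_def
      by (simp add: smult_add_left smult_add_right mult.commute del: cheb.simps)
  qed
  from this[of n] show ?thesis
    using assms by (simp add: g_def)
qed

section \<open>Ballot numbers\<close>

lemma ibinom_Suc: "ibinom (Suc n) k = ibinom n k + ibinom n (k - 1)"
proof (cases "k \<le> 0")
  case False
  then obtain m where "k = int (Suc m)"
    by (metis gr0_conv_Suc not_le_imp_less zero_less_imp_eq_int)
  then show ?thesis by (simp add: ibinom_def nat_add_distrib)
qed (auto simp: ibinom_def)

definition ballot :: "nat \<Rightarrow> nat \<Rightarrow> int" where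
  "ballot n k = ibinom (2 * n) (int n - int k) - ibinom (2 * n) (int n - int k - 1)"

lemma ballot_eq_0: "n < k \<Longrightarrow> ballot n k = 0"
  by (simp add: ballot_def ibinom_def)

lemma ballot_self: "ballot n n = 1"
  by (simp add: ballot_def ibinom_def)

lemma ballot_Suc_Suc:
  "ballot (Suc n) (Suc k) = ballot n k + 2 * ballot n (Suc k) + ballot n (Suc (Suc k))"
  by (simp add: ballot_def ibinom_Suc algebra_simps)

text \<open>Continued to \<open>k = -1\<close>, the ballot number is minus its value at
  \<open>0\<close> by the symmetry of binomials; hence the 2 of \<open>ballot_Suc_Suc\<close> drops
  to 1.\<close>

lemma ballot_Suc_0: "ballot (Suc n) 0 = ballot n 0 + ballot n 1"
proof -
  have "ibinom (2 * n) (int n - 1) = ibinom (2 * n) (int n + 1)"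
  proof (cases n)
    case (Suc m)
    have "Suc (Suc (2 * m)) choose m = Suc (Suc (2 * m)) choose (Suc (Suc m))"
      by (subst binomial_symmetric) auto
    with Suc show ?thesis
      by (simp add: ibinom_def nat_add_distrib del: binomial_Suc_Suc)
  qed (simp add: ibinom_def)
  then show ?thesis
    by (simp add: ballot_def ibinom_Suc algebra_simps)
qed

text \<open>The ballot recursion, boundary case included, is multiplication by \<open>y\<close> in
  the basis \<open>cheb 1\<close>.\<close>

lemma power_ballot:
  "[:0, 1:] ^ n = (\<Sum>k\<le>n. smult (of_int (ballot n k)) (cheb 1 k) :: 'a::comm_ring_1 poly)"
proof (induction n)
  case (Suc n)
  have "[:0, 1:] ^ Suc n = [:0, 1:] * (\<Sum>k\<le>n. smult (of_int (ballot n k)) (cheb 1 k :: 'a poly))"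
    using Suc by simp
  also have "\<dots> = (\<Sum>k\<le>Suc n. smult (of_int (ballot (Suc n) k)) (cheb 1 k))"
    by (subst times_cheb_sum)
      (auto simp: ballot_eq_0 ballot_Suc_0 ballot_Suc_Suc simp del: sum.atMost_Suc cheb.simps
        intro!: sum.cong split: nat.split)
  finally show ?case .
qed (simp add: ballot_self)

section \<open>Coefficients of the finite triple product\<close>

context non_root_of_unity
begin

text \<open>The coefficient of \<open>z^i\<close> in the product of
  \<open>(1 + z u^(j-1)) (1 + u^j / z)\<close> over \<open>1 \<le> j \<le> n\<close>;
  \<open>triple_odd\<close> has the extra factor \<open>1 + z u^n\<close>. At \<open>z^(-i)\<close>
  the coefficients are \<open>u^i * triple_even n i\<close> and
  \<open>triple_odd n (Suc i)\<close>.\<close>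

definition triple_even :: "nat \<Rightarrow> nat \<Rightarrow> 'a" where
  "triple_even n i = u ^ (i choose 2) * qbinom u (2 * n) (n + i)"

definition triple_odd :: "nat \<Rightarrow> nat \<Rightarrow> 'a" where
  "triple_odd n i = u ^ (i choose 2) * qbinom u (Suc (2 * n)) (n + i)"

lemma triple_even_eq_0: "n < i \<Longrightarrow> triple_even n i = 0"
  by (simp add: triple_even_def qbinom_eq_0)

lemma triple_odd_eq_0: "Suc n < i \<Longrightarrow> triple_odd n i = 0"
  unfolding triple_odd_def by (subst qbinom_eq_0) simp_all

lemma triple_odd_1: "triple_odd n (Suc 0) = triple_odd n 0"
  using qbinom_middle[of n] by (simp add: triple_odd_def binomial_eq_0 del: qbinom.simps)

text \<open>Multiplication by \<open>1 + u^(n+1) / z\<close>, read at \<open>z^i\<close>;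
  \<open>power_triple_even_Suc\<close> reads it at \<open>z^(-i)\<close>.\<close>

lemma triple_even_Suc: "triple_even (Suc n) i = triple_odd n i + u ^ Suc n * triple_odd n (Suc i)"
proof -
  have "qbinom u (Suc (Suc (2 * n))) (Suc (n + i))
      = qbinom u (Suc (2 * n)) (n + i) + u ^ Suc (n + i) * qbinom u (Suc (2 * n)) (Suc (n + i))"
    by (rule qbinom.simps)
  then show ?thesis
    by (simp add: triple_even_def triple_odd_def Suc_choose_two power_add algebra_simps del: qbinom.simps)
qed

lemma power_triple_even_Suc: "u ^ i * triple_even (Suc n) i = triple_odd n (Suc i) + u ^ Suc n * triple_odd n i"
proof -
  have pascal: "qbinom u (Suc (Suc (2 * n))) (Suc (n + i))
      = qbinom u (Suc (2 * n)) (Suc (n + i)) + u ^ (Suc (2 * n) - (n + i)) * qbinom u (Suc (2 * n)) (n + i)"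
    by (rule qbinom_Suc_Suc')
  have "u ^ i * (u ^ (Suc (2 * n) - (n + i)) * qbinom u (Suc (2 * n)) (n + i))
      = u ^ Suc n * qbinom u (Suc (2 * n)) (n + i)"
  proof (cases "i \<le> Suc n")
    case True
    then have "i + (Suc (2 * n) - (n + i)) = Suc n" by simp
    then show ?thesis by (simp only: mult.assoc[symmetric] power_add[symmetric])
  next
    case False
    then have "qbinom u (Suc (2 * n)) (n + i) = 0" by (intro qbinom_eq_0) simp
    then show ?thesis by (simp only: mult_zero_right)
  qed
  then have "u ^ (i choose 2) * (u ^ i * qbinom u (Suc (Suc (2 * n))) (Suc (n + i)))
      = u ^ (i choose 2) * (u ^ i * qbinom u (Suc (2 * n)) (Suc (n + i))
        + u ^ Suc n * qbinom u (Suc (2 * n)) (n + i))"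
    unfolding pascal distrib_left by (simp only:)
  then show ?thesis
    by (simp add: triple_even_def triple_odd_def Suc_choose_two power_add algebra_simps del: qbinom.simps)
qed

text \<open>Multiplication by \<open>1 + z u^n\<close>, read at \<open>z^(-i)\<close>;
  \<open>triple_odd_Suc'\<close> reads it at \<open>z^(i+1)\<close>.\<close>

lemma triple_odd_Suc: "triple_odd n (Suc i) = u ^ i * triple_even n i + u ^ n * (u ^ Suc i * triple_even n (Suc i))"
proof -
  have "qbinom u (Suc (2 * n)) (Suc (n + i))
      = qbinom u (2 * n) (n + i) + u ^ Suc (n + i) * qbinom u (2 * n) (Suc (n + i))"
    by (rule qbinom.simps)
  then show ?thesis
    by (simp add: triple_even_def triple_odd_def Suc_choose_two power_add algebra_simps del: qbinom.simps)
qed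

lemma triple_odd_Suc': "triple_odd n (Suc i) = triple_even n (Suc i) + u ^ n * triple_even n i"
proof -
  have pascal: "qbinom u (Suc (2 * n)) (Suc (n + i))
      = qbinom u (2 * n) (Suc (n + i)) + u ^ (2 * n - (n + i)) * qbinom u (2 * n) (n + i)"
    by (rule qbinom_Suc_Suc')
  have "u ^ i * (u ^ (2 * n - (n + i)) * qbinom u (2 * n) (n + i)) = u ^ n * qbinom u (2 * n) (n + i)"
  proof (cases "i \<le> n")
    case True
    then have "i + (2 * n - (n + i)) = n" by simp
    then show ?thesis by (simp only: mult.assoc[symmetric] power_add[symmetric])
  next
    case False
    then have "qbinom u (2 * n) (n + i) = 0" by (intro qbinom_eq_0) simp
    then show ?thesis by (simp only: mult_zero_right)
  qed
  then have "u ^ (i choose 2) * (u ^ i * qbinom u (Suc (2 * n)) (Suc (n + i)))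
      = u ^ (i choose 2) * (u ^ i * qbinom u (2 * n) (Suc (n + i))
        + u ^ n * qbinom u (2 * n) (n + i))"
    unfolding pascal distrib_left by (simp only:)
  then show ?thesis
    by (simp add: triple_even_def triple_odd_def Suc_choose_two power_add algebra_simps del: qbinom.simps)
qed

text \<open>Each factor of \<open>psi k\<close> is \<open>(1 + u^i w) (1 + u^i / w)\<close>, so
  \<open>(1 + w) psi k\<close> is the odd product at \<open>z = w\<close>, while
  \<open>(1 + w)\<close> times \<open>cheb 3 j\<close> is \<open>w^(j+1) + w^(-j)\<close>. The
  induction adds one factor pair at a time.\<close>

lemma psi_cheb_expansion: "psi k = (\<Sum>j\<le>k. smult (triple_odd k (Suc j)) (cheb 3 j))"
proof (induction k)
  case 0
  show ?case by (simp add: triple_odd_def binomial_eq_0)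
next
  case (Suc k)
  define v where "v = u ^ Suc k"
  define g where "g j = (case j of 0 \<Rightarrow> 3 * triple_odd k (Suc 0) + triple_odd k (Suc 1)
      | Suc j \<Rightarrow> triple_odd k (Suc j) + 2 * triple_odd k (Suc (Suc j)) + triple_odd k (Suc (Suc (Suc j))))" for j
  have y: "[:0, 1:] * psi k = (\<Sum>j\<le>Suc k. smult (g j) (cheb 3 j))"
    unfolding Suc g_def by (rule times_cheb_sum) (simp_all add: triple_odd_eq_0)
  have two_step: "triple_odd (Suc k) (Suc j) = (1 - v)\<^sup>2 * triple_odd k (Suc j) + v * g j" for j
  proof -
    have "triple_odd (Suc k) (Suc j) = triple_even (Suc k) (Suc j) + v * triple_even (Suc k) j"
      unfolding v_def by (rule triple_odd_Suc')
    also have "\<dots> = (1 + v\<^sup>2) * triple_odd k (Suc j) + v * (triple_odd k j + triple_odd k (Suc (Suc j)))"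
      unfolding triple_even_Suc v_def[symmetric] by (simp add: algebra_simps power2_eq_square)
    \<comment> \<open>At \<open>j = 0\<close> the neighbour \<open>triple_odd k 0\<close> equals
      \<open>triple_odd k 1\<close>, which turns the 2 into the 3 of \<open>cheb 3\<close>.\<close>
    also have "\<dots> = (1 - v)\<^sup>2 * triple_odd k (Suc j) + v * g j"
      by (cases j) (simp_all add: g_def triple_odd_1 algebra_simps power2_eq_square)
    finally show ?thesis .
  qed
  have "psi (Suc k) = smult ((1 - v)\<^sup>2) (psi k) + smult v ([:0, 1:] * psi k)"
    by (simp add: v_def algebra_simps)
  also note y
  also have "psi k = (\<Sum>j\<le>Suc k. smult (triple_odd k (Suc j)) (cheb 3 j))"
    by (simp add: Suc triple_odd_eq_0)
  also have "smult ((1 - v)\<^sup>2) (\<Sum>j\<le>Suc k. smult (triple_odd k (Suc j)) (cheb 3 j))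
      + smult v (\<Sum>j\<le>Suc k. smult (g j) (cheb 3 j))
      = (\<Sum>j\<le>Suc k. smult (triple_odd (Suc k) (Suc j)) (cheb 3 j))"
    unfolding smult_sum_right sum.distrib[symmetric] smult_smult smult_add_left[symmetric]
    by (simp only: two_step)
  finally show ?case .
qed

text \<open>Finite Jacobi triple product at \<open>w = 1\<close>, folded to nonnegative indices.\<close>

lemma triple_even_alternating_sum:
  assumes "Suc n < M"
  shows "(\<Sum>i<M. (-1) ^ i * (1 + u ^ i) * triple_even (Suc n) i) = triple_even (Suc n) 0"
proof -
  \<comment> \<open>Adding the recursions at \<open>i\<close> and \<open>-i\<close> makes the
    summand telescope. The two-sided sum is 0; the right-hand side remains because index 0 is
    counted twice.\<close>
  have "(1 + u ^ i) * triple_even (Suc n) i = (1 + u ^ Suc n) * (triple_odd n i + triple_odd n (Suc i))" for i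
    using triple_even_Suc[of n i] power_triple_even_Suc[of i n] by (simp add: algebra_simps)
  then have "(-1) ^ i * (1 + u ^ i) * triple_even (Suc n) i
      = (1 + u ^ Suc n) * ((-1) ^ i * triple_odd n i - (-1) ^ Suc i * triple_odd n (Suc i))" for i
    by (simp only: mult.assoc) (simp add: algebra_simps)
  then have "(\<Sum>i<M. (-1) ^ i * (1 + u ^ i) * triple_even (Suc n) i)
      = (1 + u ^ Suc n) * (\<Sum>i<M. (-1) ^ i * triple_odd n i - (-1) ^ Suc i * triple_odd n (Suc i))"
    by (simp only: sum_distrib_left)
  also have "\<dots> = (1 + u ^ Suc n) * (triple_odd n 0 - (-1) ^ M * triple_odd n M)"
    by (subst sum_lessThan_telescope') simp
  also have "\<dots> = triple_even (Suc n) 0"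
    using assms by (simp add: triple_odd_eq_0 triple_even_Suc triple_odd_1 algebra_simps)
  finally show ?thesis .
qed

text \<open>
  The derivative of the finite Jacobi triple product at \<open>w = 1\<close>, folded to nonnegative indices;
  the bound \<open>M\<close> is any number beyond the support.
\<close>

definition triple_deriv :: "nat \<Rightarrow> nat \<Rightarrow> 'a" where
  "triple_deriv M n = (\<Sum>i<M. (-1) ^ i * of_nat i * (1 - u ^ i) * triple_even n i)"

lemma triple_deriv_Suc_eq: "triple_deriv M (Suc n)
    = (1 - u ^ Suc n) * (\<Sum>i<M. (-1) ^ i * of_nat i * (triple_odd n i - triple_odd n (Suc i)))"
proof -
  have "(1 - u ^ i) * triple_even (Suc n) i = (1 - u ^ Suc n) * (triple_odd n i - triple_odd n (Suc i))" for i
    using triple_even_Suc[of n i] power_triple_even_Suc[of i n] by (simp add: algebra_simps)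
  then show ?thesis
    unfolding triple_deriv_def by (simp add: mult.assoc sum_distrib_left mult.left_commute)
qed

lemma triple_deriv_rec:
  assumes two: "(2::'a) \<noteq> 0" and M: "Suc (Suc n) < M"
  shows "triple_deriv M (Suc (Suc n)) = (1 - u ^ Suc (Suc n)) * (1 - u ^ Suc n) * triple_deriv M (Suc n)"
proof -
  define w where "w = u ^ Suc n"
  define B where "B = triple_odd (Suc n)"
  define e where "e = triple_even (Suc n)"
  \<comment> \<open>Averaging the two expansions of an odd coefficient treats \<open>i\<close> and
    \<open>-i\<close> alike; this is why the identity is doubled and 2 must be cancelled at the
    end.\<close>
  have B2: "2 * B (Suc i) = e (Suc i) + w * e i + u ^ i * e i + w * (u ^ Suc i * e (Suc i))" for i
    using triple_odd_Suc[of "Suc n" i] triple_odd_Suc'[of "Suc n" i]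
    unfolding B_def e_def w_def by simp
  \<comment> \<open>A telescoping term leaving only the derivative and the alternating sum; its
    value at 0 cancels the latter.\<close>
  define Z where "Z i = (-1) ^ i * (2 * of_nat i * B i - (2 * of_nat i - 1) * (1 + w * u ^ i) * e i)" for i
  have summand: "2 * ((-1) ^ i * of_nat i * (B i - B (Suc i)))
      = (Z i - Z (Suc i)) + 2 * (1 - w) * ((-1) ^ i * of_nat i * (1 - u ^ i) * e i)
        - (1 + w) * ((-1) ^ i * (1 + u ^ i) * e i)" for i
  proof -
    have "2 * ((-1) ^ i * of_nat i * (B i - B (Suc i))) - (Z i - Z (Suc i))
        = (-1) ^ i * ((2 * of_nat i - 1) * (1 + w * u ^ i) * e i - (2 * of_nat i + 1) * (2 * B (Suc i))
          + (2 * of_nat i + 1) * (1 + w * u ^ Suc i) * e (Suc i))"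
      unfolding Z_def by (simp add: algebra_simps)
    also have "\<dots> = 2 * (1 - w) * ((-1) ^ i * of_nat i * (1 - u ^ i) * e i)
        - (1 + w) * ((-1) ^ i * (1 + u ^ i) * e i)"
      unfolding B2 by (simp add: algebra_simps)
    finally show ?thesis by (simp only: algebra_simps)
  qed
  have alt: "(\<Sum>i<M. (-1) ^ i * (1 + u ^ i) * triple_even (Suc n) i) = triple_even (Suc n) 0"
    using M by (intro triple_even_alternating_sum) simp
  have "2 * (\<Sum>i<M. (-1) ^ i * of_nat i * (B i - B (Suc i)))
      = (Z 0 - Z M) + 2 * (1 - w) * triple_deriv M (Suc n) - (1 + w) * triple_even (Suc n) 0"
    unfolding sum_distrib_left summand
    unfolding sum_subtractf[of _ "\<lambda>i. (1 + w) * _ i"] sum.distrib sum_distrib_left[symmetric]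
      triple_deriv_def sum_lessThan_telescope' alt e_def ..
  also have "Z M = 0"
    using M by (simp add: Z_def B_def e_def triple_odd_eq_0 triple_even_eq_0)
  also have "Z 0 = (1 + w) * triple_even (Suc n) 0"
    by (simp add: Z_def e_def algebra_simps)
  finally have "2 * (\<Sum>i<M. (-1) ^ i * of_nat i * (B i - B (Suc i))) = 2 * ((1 - w) * triple_deriv M (Suc n))"
    by (simp only: mult.assoc) simp
  then have "(\<Sum>i<M. (-1) ^ i * of_nat i * (B i - B (Suc i))) = (1 - w) * triple_deriv M (Suc n)"
    using two by (simp only: mult_cancel_left simp_thms)
  then show ?thesis
    unfolding triple_deriv_Suc_eq[of M "Suc n"] B_def w_def by (simp only: mult.assoc)
qed

text \<open>At \<open>z = -1\<close> the factor \<open>1 + z\<close> vanishes, so the derivative of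
  the product is its derivative times the remaining factors.\<close>

lemma triple_deriv_eq:
  assumes two: "(2::'a) \<noteq> 0" and M: "Suc n < M"
  shows "triple_deriv M (Suc n) = - (qpoch u n * qpoch u (Suc n))"
  using M
proof (induction n)
  case 0
  have "triple_deriv M (Suc 0) = (\<Sum>i\<in>{1}. (-1) ^ i * of_nat i * (1 - u ^ i) * triple_even (Suc 0) i)"
    unfolding triple_deriv_def using 0
  proof (intro sum.mono_neutral_right ballI)
    fix i assume "i \<in> {..<M} - {1}"
    then have "i = 0 \<or> 1 < i" by auto
    then show "(-1) ^ i * of_nat i * (1 - u ^ i) * triple_even (Suc 0) i = 0"
      using triple_even_eq_0[of "Suc 0" i] by auto
  qed auto
  also have "\<dots> = - (1 - u)"
    by (simp add: triple_even_def binomial_eq_0 numeral_2_eq_2)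
  finally show ?case by simp
next
  case (Suc n)
  have "triple_deriv M (Suc (Suc n)) = (1 - u ^ Suc (Suc n)) * (1 - u ^ Suc n) * triple_deriv M (Suc n)"
    using two Suc.prems by (rule triple_deriv_rec)
  also have "triple_deriv M (Suc n) = - (qpoch u n * qpoch u (Suc n))"
    using Suc by simp
  finally show ?case
    by (simp only: qpoch.simps) (simp only: mult_minus_right mult_ac)
qed

text \<open>The index is shifted: \<open>P_seq k\<close> is \<open>P\<^bsub>k-1\<^esub>\<close>.\<close>

primrec P_seq :: "nat \<Rightarrow> 'a" where
  "P_seq 0 = 0"
| "P_seq (Suc j) = u ^ j * P_seq j + (-1) ^ j * (2 * of_nat j + 1)"

text \<open>Abel summation turns both sides into sums of \<open>P_seq (Suc i)\<close> against the
  same differences, and the recursion of \<open>P_seq\<close> then eliminates it on the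
  right.\<close>

lemma P_seq_sum:
  assumes "Suc k < M"
  shows "(\<Sum>j<M. triple_odd k (Suc j) * (P_seq (Suc (Suc j)) - P_seq j)) + triple_odd k 0
      = (\<Sum>i<M. (-1) ^ i * (2 * of_nat i + 1) * triple_even (Suc k) i)"
proof -
  have "triple_even (Suc k) i - u ^ Suc i * triple_even (Suc k) (Suc i) = triple_odd k i - triple_odd k (Suc (Suc i))" for i
    using triple_even_Suc[of k i] power_triple_even_Suc[of "Suc i" k] by simp
  then have PB: "P_seq (Suc i) * (triple_even (Suc k) i - u ^ Suc i * triple_even (Suc k) (Suc i))
      = P_seq (Suc i) * (triple_odd k i - triple_odd k (Suc (Suc i)))" for i
    by (simp only:)
  \<comment> \<open>Partial sums with their boundary terms: both are 0 at \<open>m = 0\<close>,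
    since \<open>P_seq 0 = 0\<close> and \<open>P_seq 1 = 1\<close>, and the boundary terms vanish
    at \<open>M\<close>.\<close>
  define l where "l m = (\<Sum>j<m. triple_odd k (Suc j) * (P_seq (Suc (Suc j)) - P_seq j)) + triple_odd k 0
        - triple_odd k m * P_seq (Suc m) - triple_odd k (Suc m) * P_seq m" for m
  define r where "r m = (\<Sum>i<m. (P_seq (Suc i) - u ^ i * P_seq i) * triple_even (Suc k) i)
        - u ^ m * P_seq m * triple_even (Suc k) m" for m
  have "l m = r m" for m
  proof (induction m)
    case (Suc m)
    have "l (Suc m) = l m + P_seq (Suc m) * (triple_odd k m - triple_odd k (Suc (Suc m)))"
      by (simp add: l_def algebra_simps del: P_seq.simps)
    also have "\<dots> = r m + P_seq (Suc m) * (triple_even (Suc k) m - u ^ Suc m * triple_even (Suc k) (Suc m))"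
      by (simp only: Suc PB)
    also have "\<dots> = r (Suc m)"
      by (simp add: r_def algebra_simps del: P_seq.simps)
    finally show ?case .
  qed (simp add: l_def r_def)
  from this[of M] show ?thesis
    using assms by (simp add: l_def r_def triple_odd_eq_0 triple_even_eq_0)
qed

text \<open>The left side is \<open>(u - 1) * L (psi k)\<close> once \<open>L\<close> is known on
  \<open>cheb 3\<close>. After \<open>P_seq_sum\<close> it differs from \<open>triple_deriv\<close>
  only by a telescoping sum.\<close>

lemma P_seq_triple_odd_sum:
  assumes two: "(2::'a) \<noteq> 0"
  shows "(\<Sum>j\<le>k. triple_odd k (Suc j) * (P_seq (Suc (Suc j)) - P_seq j + 2 * (-1) ^ j))
      = - (qpoch u k * qpoch u (Suc k))"
proof -
  define M where "M = Suc (Suc k)"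
  define v where "v = u ^ Suc k"
  define Z where "Z i = (-1) ^ i * (of_nat i + 1 + of_nat i * v) * triple_odd k i" for i
  have "(-1) ^ i * (2 * of_nat i + 1) * triple_even (Suc k) i + triple_odd k (Suc i) * (2 * (-1) ^ i)
      = (Z i - Z (Suc i)) + (-1) ^ i * of_nat i * (1 - u ^ i) * triple_even (Suc k) i" for i
  proof -
    have "(-1) ^ i * (2 * of_nat i + 1) * triple_even (Suc k) i + triple_odd k (Suc i) * (2 * (-1) ^ i)
        - (-1) ^ i * of_nat i * (1 - u ^ i) * triple_even (Suc k) i
        = (-1) ^ i * ((of_nat i + 1) * triple_even (Suc k) i + of_nat i * (u ^ i * triple_even (Suc k) i)
          + 2 * triple_odd k (Suc i))"
      by (simp add: algebra_simps)
    also have "\<dots> = Z i - Z (Suc i)"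
      unfolding power_triple_even_Suc[of i k] unfolding triple_even_Suc[of k i] Z_def v_def[symmetric]
      by (simp add: algebra_simps)
    finally show ?thesis by (simp only: algebra_simps)
  qed
  then have "(\<Sum>i<M. (-1) ^ i * (2 * of_nat i + 1) * triple_even (Suc k) i)
        + (\<Sum>i<M. triple_odd k (Suc i) * (2 * (-1) ^ i))
      = (Z 0 - Z M) + triple_deriv M (Suc k)"
    by (simp add: sum_lessThan_telescope' triple_deriv_def flip: sum.distrib)
       (simp add: sum.distrib sum_lessThan_telescope')
  also have "(\<Sum>i<M. (-1) ^ i * (2 * of_nat i + 1) * triple_even (Suc k) i)
      = (\<Sum>j<M. triple_odd k (Suc j) * (P_seq (Suc (Suc j)) - P_seq j)) + triple_odd k 0"
    by (rule P_seq_sum[symmetric]) (simp add: M_def)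
  also have "Z 0 - Z M = triple_odd k 0"
    by (simp add: Z_def M_def triple_odd_eq_0)
  also have "triple_deriv M (Suc k) = - (qpoch u k * qpoch u (Suc k))"
    using two by (rule triple_deriv_eq) (simp add: M_def)
  finally have "(\<Sum>j<M. triple_odd k (Suc j) * (P_seq (Suc (Suc j)) - P_seq j + 2 * (-1) ^ j))
      = - (qpoch u k * qpoch u (Suc k))"
    unfolding distrib_left sum.distrib by (simp only: add_ac add_left_cancel)
  then show ?thesis
    by (simp add: M_def triple_odd_eq_0 lessThan_Suc_atMost)
qed

lemma functional_psi:
  assumes "poly_functional L" and two: "(2::'a) \<noteq> 0"
    and chi: "\<And>k. L (cheb 1 k) = (P_seq k + 2 * P_seq (Suc k) + P_seq (Suc (Suc k))) / (u - 1)"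
  shows "L (psi k) = qpoch u k * qpoch u (Suc k) / (1 - u)"
proof -
  interpret poly_functional L by fact
  have nz: "u - 1 \<noteq> 0" using u_power_neq_1[of 1] by simp
  \<comment> \<open>\<open>cheb_3_add\<close> determines these values up to a multiple of
    \<open>(-1) ^ j\<close>, which the case \<open>j = 0\<close> fixes.\<close>
  have t: "L (cheb 3 j) = (P_seq (Suc (Suc j)) - P_seq j + 2 * (-1) ^ j) / (u - 1)" for j
  proof (induction j)
    case 0
    show ?case using chi[of 0] by simp
  next
    case (Suc j)
    have "L (cheb 3 (Suc j)) + L (cheb 3 j) = L (cheb 1 (Suc j)) - L (cheb 1 j)"
      by (simp only: L_add[symmetric] L_diff[symmetric] cheb_3_add)
    then have "L (cheb 3 (Suc j)) = L (cheb 1 (Suc j)) - L (cheb 1 j) - L (cheb 3 j)"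
      by (simp only: algebra_simps)
    then show ?case
      unfolding chi Suc diff_divide_distrib[symmetric]
      by (simp only: power_Suc) (simp add: algebra_simps del: P_seq.simps)
  qed
  have "L (psi k) = (\<Sum>j\<le>k. triple_odd k (Suc j) * (P_seq (Suc (Suc j)) - P_seq j + 2 * (-1) ^ j)) / (u - 1)"
    unfolding psi_cheb_expansion L_sum L_smult t sum_divide_distrib by simp
  also have "\<dots> = - (qpoch u k * qpoch u (Suc k)) / (u - 1)"
    by (simp only: P_seq_triple_odd_sum[OF two])
  also have "\<dots> = qpoch u k * qpoch u (Suc k) / (1 - u)"
    by (metis minus_diff_eq minus_divide_divide minus_minus)
  finally show ?thesis .
qed

end

section \<open>Specialization to the indeterminate\<close>

definition moment_functional :: "(nat \<Rightarrow> 'a::field) \<Rightarrow> 'a poly \<Rightarrow> 'a" where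
  "moment_functional \<mu> p = (\<Sum>i\<le>degree p. coeff p i * \<mu> i)"

lemma moment_functional_eq:
  assumes "degree p \<le> N"
  shows "moment_functional \<mu> p = (\<Sum>i\<le>N. coeff p i * \<mu> i)"
  unfolding moment_functional_def
  using assms by (intro sum.mono_neutral_left) (auto simp: coeff_eq_0)

lemma poly_functional_moment_functional: "poly_functional (moment_functional \<mu>)"
proof
  fix p r :: "'a poly" and x :: 'a
  define N where "N = max (degree p) (degree r)"
  have "degree p \<le> N" "degree r \<le> N" "degree (p + r) \<le> N"
    by (auto simp: N_def intro: degree_add_le)
  then show "moment_functional \<mu> (p + r) = moment_functional \<mu> p + moment_functional \<mu> r"
    by (simp add: moment_functional_eq[of _ N] sum.distrib algebra_simps)
  show "moment_functional \<mu> (smult x p) = x * moment_functional \<mu> p"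
    by (subst moment_functional_eq[of _ "degree p"])
      (simp_all add: moment_functional_def sum_distrib_left mult.assoc)
qed

lemma moment_functional_power: "moment_functional \<mu> ([:0, 1:] ^ n) = \<mu> n"
proof -
  have "moment_functional \<mu> (monom 1 n) = (\<Sum>i\<le>n. coeff (monom 1 n) i * \<mu> i)"
    by (rule moment_functional_eq) (rule degree_monom_le)
  also have "\<dots> = (\<Sum>i\<le>n. if i = n then \<mu> i else 0)"
    by (intro sum.cong) auto
  also have "\<dots> = \<mu> n"
    by simp
  finally show ?thesis by (simp add: monom_altdef)
qed

text \<open>The expansion \<open>power_ballot\<close> is unitriangular, so the moments determine the
  values on \<open>cheb 1\<close>.\<close>

lemma (in poly_functional) L_cheb:
  assumes "\<And>n. L ([:0, 1:] ^ n) = (\<Sum>k\<le>n. of_int (ballot n k) * y k)"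
  shows "L (cheb 1 k) = y k"
proof (induction k rule: less_induct)
  case (less k)
  have "(\<Sum>j\<le>k. of_int (ballot k j) * L (cheb 1 j)) = (\<Sum>j\<le>k. of_int (ballot k j) * y j)"
    unfolding assms[symmetric] power_ballot L_sum L_smult ..
  moreover have "(\<Sum>j<k. of_int (ballot k j) * L (cheb 1 j)) = (\<Sum>j<k. of_int (ballot k j) * y j)"
    using less by (intro sum.cong) simp_all
  ultimately show ?case
    by (simp add: lessThan_Suc_atMost[symmetric] ballot_self)
qed

lemma to_fract_power: "to_fract (p ^ n) = to_fract p ^ n"
  by (induction n) simp_all

lemma of_int_fract: "(of_int x :: int poly fract) = to_fract [:x:]"
proof -
  have nat: "(of_nat m :: int poly fract) = to_fract [:int m:]" for m
    by (induction m) (simp_all add: add.commute one_pCons flip: to_fract_add to_fract_1)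
  show ?thesis
    by (cases x rule: int_diff_cases) (simp add: nat flip: to_fract_diff)
qed

interpretation q: non_root_of_unity q
proof
  show "q \<noteq> 0" by (simp add: q_def)
  fix m :: nat assume "m > 0"
  then have "coeff (monom 1 m) 0 \<noteq> coeff (1 :: int poly) 0" by simp
  then have "[:0, 1:] ^ m \<noteq> (1 :: int poly)"
    by (auto simp: monom_altdef)
  then show "q ^ m \<noteq> 1"
    unfolding q_def by (simp flip: to_fract_power to_fract_1)
qed

lemma P_int_Suc:
  "P (int k) = monom 1 k * P (int k - 1) + monom ((-1) ^ k * (2 * int k + 1)) 0"
proof -
  have exp: "k + ((k choose 2) - (Suc i choose 2)) = (Suc k choose 2) - (Suc i choose 2)" if "i < k" for i
  proof -
    have "Suc i choose 2 \<le> k choose 2"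
      using that by (intro binomial_right_mono) simp
    then show ?thesis by (simp add: Suc_choose_two[of k])
  qed
  have "P (int k) = (\<Sum>i=0..<Suc k. monom ((-1) ^ i * (2 * int i + 1)) ((Suc k choose 2) - (Suc i choose 2)))"
    by (simp add: P_def nat_add_distrib del: sum.op_ivl_Suc)
  also have "\<dots> = (\<Sum>i=0..<k. monom 1 k * monom ((-1) ^ i * (2 * int i + 1)) ((k choose 2) - (Suc i choose 2)))
      + monom ((-1) ^ k * (2 * int k + 1)) 0"
    by (simp add: mult_monom exp)
  finally show ?thesis
    by (simp add: P_def sum_distrib_left)
qed

lemma to_fract_P: "to_fract (P (int k - 1)) = q.P_seq k"
proof (induction k)
  case 0
  show ?case by (simp add: P_def)
next
  case (Suc k)
  have "to_fract (monom 1 k) = q ^ k"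
    by (simp add: q_def monom_altdef to_fract_power)
  moreover have "to_fract (monom ((-1) ^ k * (2 * int k + 1)) 0) = (-1) ^ k * (2 * of_nat k + 1)"
    using of_int_fract[of "(-1) ^ k * (2 * int k + 1)"] by (simp add: monom_0)
  ultimately show ?case
    using Suc P_int_Suc[of k] by simp
qed

lemma Y_eq: "Y k = (q.P_seq k + 2 * q.P_seq (Suc k) + q.P_seq (Suc (Suc k))) / (q - 1)"
proof -
  have "to_fract 2 = (2 :: int poly fract)"
    using to_fract_add[of "1 :: int poly" 1] by simp
  then show ?thesis
    using to_fract_P[of k] to_fract_P[of "Suc k"] to_fract_P[of "Suc (Suc k)"]
    by (simp add: Y_def algebra_simps del: q.P_seq.simps)
qed

lemma poly_P_1: "poly (P (int k - 1)) 1 = - ((-1) ^ k) * int k"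
  by (induction k) (simp add: P_def, simp add: P_int_Suc poly_monom algebra_simps)

lemma Y_polynomial: "\<exists>p. Y k = to_fract p"
proof -
  define R where "R = P (int k - 1) + 2 * P (int k) + P (int k + 1)"
  \<comment> \<open>Up to a common sign the three values at \<open>q = 1\<close> are
    \<open>k\<close>, \<open>-(k+1)\<close>, \<open>k+2\<close>, so a second difference of a linear
    function remains.\<close>
  have "poly R 1 = 0"
    using poly_P_1[of k] poly_P_1[of "Suc k"] poly_P_1[of "Suc (Suc k)"]
    by (simp add: R_def algebra_simps)
  then obtain p where p: "R = [:-1, 1:] * p"
    by (auto simp: poly_eq_0_iff_dvd)
  have "to_fract [:-1, 1:] = q - 1"
    by (simp add: q_def one_pCons flip: to_fract_1 to_fract_diff)
  moreover have "q - 1 \<noteq> 0"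
    using q.u_power_neq_1[of 1] by simp
  ultimately have "Y k = to_fract p"
    by (simp add: Y_def R_def[symmetric] p del: mult_pCons_left)
  then show ?thesis ..
qed

theorem theorem9p1:
  shows "(\<forall>k. \<exists>p :: int poly. Y k = to_fract p) \<and>
    (\<forall>n. G2 (n + 1) = 1 / (1 - q) ^ (2 * n) *
      (\<Sum>k = 0..n. of_int (ibinom (2 * n) (int n - int k)
                         - ibinom (2 * n) (int n - int k - 1)) * Y k))"
proof (intro conjI allI)
  show "\<exists>p. Y k = to_fract p" for k
    by (rule Y_polynomial)
next
  fix n
  define \<mu> where "\<mu> n = (\<Sum>k\<le>n. of_int (ballot n k) * Y k)" for n
  define L where "L = moment_functional \<mu>"
  interpret poly_functional L
    unfolding L_def by (rule poly_functional_moment_functional)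
  have L_power: "L ([:0, 1:] ^ n) = \<mu> n" for n
    unfolding L_def by (rule moment_functional_power)
  have nz: "1 - q \<noteq> 0" using q.u_power_neq_1[of 1] by simp
  have two: "(2 :: int poly fract) \<noteq> 0"
    using of_int_fract[of 2] by simp
  have chi: "L (cheb 1 k) = Y k" for k
    using L_power by (intro L_cheb) (simp add: \<mu>_def)
  have psi: "L (q.psi k) = qpoch q k * qpoch q (Suc k) / (1 - q)" for k
    using poly_functional_axioms two by (rule q.functional_psi) (simp add: chi Y_eq)
  \<comment> \<open>The factor \<open>(1 - q)^2\<close> clears the denominators of
    \<open>lam\<close>; its \<open>n\<close>-th power is the prefactor of the theorem.\<close>
  define b where "b j = (1 - q)\<^sup>2 * lam j" for j
  have b_odd: "b (2 * n + 1) = (1 - q ^ Suc n)\<^sup>2" for n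
    using nz by (simp add: b_def lam_def qint_def power_divide)
  have b_even: "b (2 * Suc n) = (1 - q ^ Suc n) * (1 - q ^ Suc (Suc n))" for n
    using nz by (simp add: b_def lam_def qint_def power2_eq_square)
  have "L 1 = 1"
    using psi[of 0] nz by simp
  then have "L ([:0, 1:] ^ n) = ((1 - q)\<^sup>2) ^ n * fps_nth (S_fraction lam) n"
    by (intro moments_eq_S_fraction[of b] q.half_orth_functional_zero[OF poly_functional_axioms psi b_odd b_even])
      (simp_all add: b_def)
  then have "\<mu> n = (1 - q) ^ (2 * n) * G2 (n + 1)"
    by (simp add: L_power G2_def power_mult)
  then show "G2 (n + 1) = 1 / (1 - q) ^ (2 * n) *
      (\<Sum>k = 0..n. of_int (ibinom (2 * n) (int n - int k)
                         - ibinom (2 * n) (int n - int k - 1)) * Y k)"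
    using nz by (simp add: \<mu>_def ballot_def atMost_atLeast0)
qed

end
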